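(* Let $T_{a,w}$ be a weighted translation on $L^p(G)$, $1\le p<\infty$, and let $A,B\subset\mathbb{N}$ with $\overline{\mathrm{dens}}(A)=\overline{\mathrm{dens}}(B)=1$. If $DIV_{A,B}(T_{a,w})$ is nonempty, then $DIV_{A,\bullet}(T_{a,w})$ is path connected.
   Context: $G$ is a second countable locally compact Hausdorff group with a right invariant Haar measure $\lambda$; $L^p(G)$ is the complex Lebesgue space with respect to $\lambda$. A weight on $G$ is a bounded continuous function $w:G\to(0,\infty)$. For $a\in G$, $(T_af)(x):=f(xa^{-1})$ and the weighted translation is $T_{a,w}f:=w\,T_af$ for $f\in L^p(G)$. For $A\subset\mathbb{N}=\{1,2,\dots\}$, $\overline{\mathrm{dens}}(A)=\limsup_{n\to\infty}\frac{\mathrm{card}(A\cap[1,n])}{n}$; $\lim_{n\in A}$ means the limit as $n\to\infty$ with $n\in A$. For an operator $T$ on a Banach space $X$ and $A,B\subset\mathbb{N}$ with $\overline{\mathrm{dens}}(A)=\overline{\mathrm{dens}}(B)=1$, define $X_{0,A}(T)=\{x\in X:\lim_{n\in A}T^nx=0\}$ and $DIV_{A,B}(T)=\{x\in X:\lim_{n\in A}T^nx=0\text{ and }\lim_{n\in B}\|T^nx\|=\infty\}$. A vector $x$ is distributionally irregular for $T$ if $x\in DIV_{A,B}(T)$ for some such $A,B$; $DIV(T)$ is the set of all distributionally irregular vectors. Finally $DIV_{A,\bullet}(T):=DIV(T)\cap X_{0,A}(T)=\bigcup_{\overline{\mathrm{dens}}(B')=1}DIV_{A,B'}(T)$. Path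 connectedness is with respect to the norm topology. *)

theory Defs
  imports "HOL-Analysis.Analysis"
begin

definition Lp_funs :: "real \<Rightarrow> 'a measure \<Rightarrow> ('a \<Rightarrow> complex) set" where
  "Lp_funs p M = {f \<in> borel_measurable M. integrable M (\<lambda>x. norm (f x) powr p)}"

definition Lp_seminorm :: "real \<Rightarrow> 'a measure \<Rightarrow> ('a \<Rightarrow> complex) \<Rightarrow> real" where
  "Lp_seminorm p M f = (\<integral>x. norm (f x) powr p \<partial>M) powr (1 / p)"

definition Lp_rel :: "real \<Rightarrow> 'a measure \<Rightarrow> (('a \<Rightarrow> complex) \<times> ('a \<Rightarrow> complex)) set" where
  "Lp_rel p M = {(f, g). f \<in> Lp_funs p M \<and> g \<in> Lp_funs p M \<and> (AE x in M. f x = g x)}"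

definition Lp :: "real \<Rightarrow> 'a measure \<Rightarrow> ('a \<Rightarrow> complex) set set" where
  "Lp p M = Lp_funs p M // Lp_rel p M"

definition Lp_class :: "real \<Rightarrow> 'a measure \<Rightarrow> ('a \<Rightarrow> complex) \<Rightarrow> ('a \<Rightarrow> complex) set" where
  "Lp_class p M f = Lp_rel p M `` {f}"

text \<open>
  Norm, distance and operators on \<^const>\<open>Lp\<close> are evaluated on a chosen representative; the
  lemmas below show that the choice is irrelevant.
\<close>

definition Lp_rep :: "('a \<Rightarrow> complex) set \<Rightarrow> 'a \<Rightarrow> complex" where
  "Lp_rep F = (SOME f. f \<in> F)"

definition Lp_norm :: "real \<Rightarrow> 'a measure \<Rightarrow> ('a \<Rightarrow> complex) set \<Rightarrow> real" where
  "Lp_norm p M F = Lp_seminorm p M (Lp_rep F)"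

definition Lp_dist :: "real \<Rightarrow> 'a measure \<Rightarrow> ('a \<Rightarrow> complex) set \<Rightarrow> ('a \<Rightarrow> complex) set \<Rightarrow> real" where
  "Lp_dist p M F G = Lp_seminorm p M (\<lambda>x. Lp_rep F x - Lp_rep G x)"

definition Lp_topology :: "real \<Rightarrow> 'a measure \<Rightarrow> ('a \<Rightarrow> complex) set topology" where
  "Lp_topology p M = Metric_space.mtopology (Lp p M) (Lp_dist p M)"

lemma equiv_Lp_rel: "equiv (Lp_funs p M) (Lp_rel p M)"
proof (rule equivI)
  show "Lp_rel p M \<subseteq> Lp_funs p M \<times> Lp_funs p M" by (auto simp: Lp_rel_def)
  show "refl_on (Lp_funs p M) (Lp_rel p M)" by (auto simp: refl_on_def Lp_rel_def)
  show "sym (Lp_rel p M)" by (auto simp: sym_def Lp_rel_def eq_commute)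
  show "trans (Lp_rel p M)"
  proof (rule transI)
    fix f g h assume "(f, g) \<in> Lp_rel p M" "(g, h) \<in> Lp_rel p M"
    moreover from this have "AE x in M. f x = g x" "AE x in M. g x = h x"
      by (auto simp: Lp_rel_def)
    then have "AE x in M. f x = h x" by eventually_elim simp
    ultimately show "(f, h) \<in> Lp_rel p M" by (auto simp: Lp_rel_def)
  qed
qed

lemma Lp_class_in_Lp: "f \<in> Lp_funs p M \<Longrightarrow> Lp_class p M f \<in> Lp p M"
  by (simp add: Lp_class_def Lp_def quotientI)

lemma Lp_class_eq_iff:
  assumes "f \<in> Lp_funs p M" "g \<in> Lp_funs p M"
  shows "Lp_class p M f = Lp_class p M g \<longleftrightarrow> (AE x in M. f x = g x)"
  unfolding Lp_class_def
  by (subst eq_equiv_class_iff[OF equiv_Lp_rel assms]) (simp add: Lp_rel_def assms)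

lemma Lp_rep:
  assumes "F \<in> Lp p M"
  shows Lp_rep_mem: "Lp_rep F \<in> F" and Lp_rep_in_funs: "Lp_rep F \<in> Lp_funs p M"
    and Lp_class_rep: "Lp_class p M (Lp_rep F) = F"
proof -
  obtain f where f: "f \<in> Lp_funs p M" "F = Lp_rel p M `` {f}"
    using assms unfolding Lp_def by (auto elim: quotientE)
  then have "f \<in> F" by (auto simp: Lp_rel_def)
  then show m: "Lp_rep F \<in> F" unfolding Lp_rep_def by (rule someI[where P = "\<lambda>f. f \<in> F"])
  then show "Lp_rep F \<in> Lp_funs p M" using f by (auto simp: Lp_rel_def)
  show "Lp_class p M (Lp_rep F) = F"
    using equiv_class_eq[OF equiv_Lp_rel, of f "Lp_rep F" p M] m f(2)
    by (simp add: Lp_class_def)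
qed

lemma Lp_rep_class:
  assumes "f \<in> Lp_funs p M"
  shows "AE x in M. Lp_rep (Lp_class p M f) x = f x"
proof -
  have "Lp_rep (Lp_class p M f) \<in> Lp_class p M f"
    by (rule Lp_rep_mem[OF Lp_class_in_Lp[OF assms]])
  then have "(f, Lp_rep (Lp_class p M f)) \<in> Lp_rel p M"
    unfolding Lp_class_def by blast
  then have "AE x in M. f x = Lp_rep (Lp_class p M f) x"
    by (simp add: Lp_rel_def)
  then show ?thesis by eventually_elim simp
qed

lemma Lp_seminorm_cong_AE:
  assumes "f \<in> borel_measurable M" "g \<in> borel_measurable M" "AE x in M. f x = g x"
  shows "Lp_seminorm p M f = Lp_seminorm p M g"
proof -
  have "AE x in M. norm (f x) powr p = norm (g x) powr p"
    using assms(3) by eventually_elim simp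
  then have "(\<integral>x. norm (f x) powr p \<partial>M) = (\<integral>x. norm (g x) powr p \<partial>M)"
    using assms(1,2) by (intro integral_cong_AE) auto
  then show ?thesis by (simp add: Lp_seminorm_def)
qed

lemma Lp_funsD: "f \<in> Lp_funs p M \<Longrightarrow> f \<in> borel_measurable M"
  by (simp add: Lp_funs_def)

lemma Lp_norm_class:
  assumes "f \<in> Lp_funs p M"
  shows "Lp_norm p M (Lp_class p M f) = Lp_seminorm p M f"
  unfolding Lp_norm_def
  by (rule Lp_seminorm_cong_AE[OF Lp_funsD[OF Lp_rep_in_funs[OF Lp_class_in_Lp[OF assms]]]
        Lp_funsD[OF assms] Lp_rep_class[OF assms]])

lemma Lp_dist_class:
  assumes f: "f \<in> Lp_funs p M" and g: "g \<in> Lp_funs p M"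
  shows "Lp_dist p M (Lp_class p M f) (Lp_class p M g) = Lp_seminorm p M (\<lambda>x. f x - g x)"
proof -
  have "AE x in M. Lp_rep (Lp_class p M f) x - Lp_rep (Lp_class p M g) x = f x - g x"
    using Lp_rep_class[OF f] Lp_rep_class[OF g] by eventually_elim simp
  then show ?thesis unfolding Lp_dist_def
    using Lp_funsD[OF f] Lp_funsD[OF g]
      Lp_funsD[OF Lp_rep_in_funs[OF Lp_class_in_Lp[OF f]]]
      Lp_funsD[OF Lp_rep_in_funs[OF Lp_class_in_Lp[OF g]]]
    by (intro Lp_seminorm_cong_AE) auto
qed

lemma powr_convex_nonneg:
  fixes s t u v p :: real
  assumes p: "1 \<le> p" and "0 \<le> s" "0 \<le> t" "0 \<le> u" "0 \<le> v" "u + v = 1"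
  shows "(u * s + v * t) powr p \<le> u * s powr p + v * t powr p"
proof -
  have le: "c powr p \<le> c" if "0 \<le> c" "c \<le> 1" for c :: real
    using powr_le_one_le[of c p] that p by (cases "c = 0") auto
  show ?thesis
  proof (cases "s = 0 \<or> t = 0")
    case True
    have "(u * s) powr p \<le> u * s powr p" "(v * t) powr p \<le> v * t powr p"
      using le[of u] le[of v] assms by (auto simp: powr_mult intro!: mult_right_mono)
    then show ?thesis using True by auto
  next
    case False
    then have "s \<in> {0<..}" "t \<in> {0<..}" using assms by auto
    moreover have "u = 1 - v" "v \<le> 1" using assms by auto
    ultimately show ?thesis
      using convex_onD[OF powr_convex[OF p], of v s t] assms(5)
      by (simp only: \<open>u = 1 - v\<close>) simp
  qed
qed

lemma Lp_seminorm_powr: "1 \<le> p \<Longrightarrow> Lp_seminorm p M f powr p = (\<integral>x. norm (f x) powr p \<partial>M)"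
  by (simp add: Lp_seminorm_def powr_powr)

lemma Lp_seminorm_eq_0_iff:
  assumes "f \<in> Lp_funs p M" "1 \<le> p"
  shows "Lp_seminorm p M f = 0 \<longleftrightarrow> (AE x in M. f x = 0)"
proof -
  have "Lp_seminorm p M f = 0 \<longleftrightarrow> (\<integral>x. norm (f x) powr p \<partial>M) = 0"
    by (simp add: Lp_seminorm_def)
  also have "\<dots> \<longleftrightarrow> (AE x in M. norm (f x) powr p = 0)"
    using assms by (intro integral_nonneg_eq_0_iff_AE) (auto simp: Lp_funs_def)
  finally show ?thesis by simp
qed

lemma Minkowski_aux:
  fixes a b s t p :: real
  assumes p: "1 \<le> p" and "0 < a" "0 < b" "0 \<le> s" "0 \<le> t"
  shows "(s + t) powr p
    \<le> (a + b) powr p * (a / (a + b) * (s powr p / a powr p) + b / (a + b) * (t powr p / b powr p))"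
proof -
  have "a / (a + b) * (s / a) + b / (a + b) * (t / b) = (s + t) / (a + b)"
    using assms by (simp add: add_divide_distrib)
  moreover have "a / (a + b) + b / (a + b) = 1"
    using assms by (simp add: add_divide_distrib[symmetric])
  ultimately have "((s + t) / (a + b)) powr p
      \<le> a / (a + b) * (s / a) powr p + b / (a + b) * (t / b) powr p"
    using powr_convex_nonneg[OF p, of "s / a" "t / b" "a / (a + b)" "b / (a + b)"] assms by simp
  then have "(s + t) powr p / (a + b) powr p
      \<le> a / (a + b) * (s powr p / a powr p) + b / (a + b) * (t powr p / b powr p)"
    using assms by (simp add: powr_divide)
  then show ?thesis
    using assms by (simp add: pos_divide_le_eq mult.commute)
qed

lemma
  assumes p: "1 \<le> p" and f: "f \<in> Lp_funs p M" and g: "g \<in> Lp_funs p M"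
  shows Lp_funs_add: "(\<lambda>x. f x + g x) \<in> Lp_funs p M"
    and Lp_seminorm_triangle:
      "Lp_seminorm p M (\<lambda>x. f x + g x) \<le> Lp_seminorm p M f + Lp_seminorm p M g"
proof -
  have [measurable]: "f \<in> borel_measurable M" "g \<in> borel_measurable M"
    and int: "integrable M (\<lambda>x. norm (f x) powr p)" "integrable M (\<lambda>x. norm (g x) powr p)"
    using f g by (auto simp: Lp_funs_def)
  define bd where "bd a b = (\<lambda>x. (a + b) powr p * (a / (a + b) * (norm (f x) powr p / a powr p)
    + b / (a + b) * (norm (g x) powr p / b powr p)))" for a b
  have bd: "norm (f x + g x) powr p \<le> bd a b x" if "0 < a" "0 < b" for a b x
  proof -
    have "norm (f x + g x) powr p \<le> (norm (f x) + norm (g x)) powr p"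
      using p by (intro powr_mono2 norm_triangle_ineq) auto
    also have "\<dots> \<le> bd a b x"
      unfolding bd_def using Minkowski_aux[OF p that, of "norm (f x)" "norm (g x)"] by simp
    finally show ?thesis .
  qed
  have ibd: "integrable M (bd a b)" for a b
    unfolding bd_def using int by simp
  have isum: "integrable M (\<lambda>x. norm (f x + g x) powr p)"
    by (rule Bochner_Integration.integrable_bound[OF ibd[of 1 1]])
       (use bd[of 1 1] in \<open>auto intro!: AE_I2 intro: order_trans[OF _ abs_ge_self]\<close>)
  then show "(\<lambda>x. f x + g x) \<in> Lp_funs p M" by (simp add: Lp_funs_def)
  let ?a = "Lp_seminorm p M f" and ?b = "Lp_seminorm p M g"
  have nn: "?a \<ge> 0" "?b \<ge> 0" by (simp_all add: Lp_seminorm_def)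
  show "Lp_seminorm p M (\<lambda>x. f x + g x) \<le> ?a + ?b"
  proof (cases "?a = 0 \<or> ?b = 0")
    case True
    then show ?thesis
    proof
      assume "?a = 0"
      then have "AE x in M. f x = 0" using Lp_seminorm_eq_0_iff[OF f p] by simp
      then have "AE x in M. f x + g x = g x" by eventually_elim simp
      then have "Lp_seminorm p M (\<lambda>x. f x + g x) = ?b" by (intro Lp_seminorm_cong_AE) auto
      then show ?thesis using nn by simp
    next
      assume "?b = 0"
      then have "AE x in M. g x = 0" using Lp_seminorm_eq_0_iff[OF g p] by simp
      then have "AE x in M. f x + g x = f x" by eventually_elim simp
      then have "Lp_seminorm p M (\<lambda>x. f x + g x) = ?a" by (intro Lp_seminorm_cong_AE) auto
      then show ?thesis using nn by simp
    qed
  next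
    case False
    then have pos: "0 < ?a" "0 < ?b" using nn by auto
    have "(\<integral>x. norm (f x + g x) powr p \<partial>M) \<le> (\<integral>x. bd ?a ?b x \<partial>M)"
      by (intro integral_mono isum ibd bd pos)
    also have "\<dots> = (?a + ?b) powr p * (?a / (?a + ?b) * (?a powr p / ?a powr p)
        + ?b / (?a + ?b) * (?b powr p / ?b powr p))"
      unfolding bd_def using int p by (simp add: Lp_seminorm_powr)
    also have "\<dots> = (?a + ?b) powr p"
      using pos by (simp add: add_divide_distrib[symmetric])
    finally have "(\<integral>x. norm (f x + g x) powr p \<partial>M) powr (1 / p) \<le> ((?a + ?b) powr p) powr (1 / p)"
      using p by (intro powr_mono2) auto
    then show ?thesis using pos p by (simp add: Lp_seminorm_def powr_powr)
  qed
qed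

lemma Lp_funs_diff:
  assumes "1 \<le> p" "f \<in> Lp_funs p M" "g \<in> Lp_funs p M"
  shows "(\<lambda>x. f x - g x) \<in> Lp_funs p M"
  using Lp_funs_add[of p f M "\<lambda>x. - g x"] assms by (simp add: Lp_funs_def)

lemma Metric_space_Lp:
  assumes p: "1 \<le> p"
  shows "Metric_space (Lp p M) (Lp_dist p M)"
proof
  fix F G H :: "('a \<Rightarrow> complex) set"
  show "0 \<le> Lp_dist p M F G" by (simp add: Lp_dist_def Lp_seminorm_def)
  show "Lp_dist p M F G = Lp_dist p M G F"
    by (simp add: Lp_dist_def Lp_seminorm_def norm_minus_commute)
  assume F: "F \<in> Lp p M" and G: "G \<in> Lp p M"
  note rep = Lp_rep_in_funs[OF F] Lp_rep_in_funs[OF G]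
  have "Lp_dist p M F G = 0 \<longleftrightarrow> (AE x in M. Lp_rep F x - Lp_rep G x = 0)"
    unfolding Lp_dist_def by (rule Lp_seminorm_eq_0_iff[OF Lp_funs_diff[OF p rep] p])
  also have "\<dots> \<longleftrightarrow> F = G"
    using Lp_class_eq_iff[OF rep] by (simp add: Lp_class_rep[OF F] Lp_class_rep[OF G])
  finally show "Lp_dist p M F G = 0 \<longleftrightarrow> F = G" .
  assume H: "H \<in> Lp p M"
  show "Lp_dist p M F H \<le> Lp_dist p M F G + Lp_dist p M G H"
    using Lp_seminorm_triangle[OF p Lp_funs_diff[OF p rep]
        Lp_funs_diff[OF p rep(2) Lp_rep_in_funs[OF H]]]
    by (simp add: Lp_dist_def)
qed

definition upper_density :: "nat set \<Rightarrow> ereal" where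
  "upper_density A = limsup (\<lambda>n. ereal (real (card (A \<inter> {1..n})) / real n))"

definition full_upper_density :: "nat set \<Rightarrow> bool" where
  "full_upper_density A \<longleftrightarrow> A \<subseteq> {1..} \<and> upper_density A = 1"

text \<open>
  The normed space is given by a carrier \<open>X\<close> and a norm function \<open>N\<close>; the filter
  \<open>inf sequentially (principal A)\<close> expresses \<open>n \<rightarrow> \<infinity>\<close> with \<open>n \<in> A\<close>.
  Convergence of \<open>T\<^sup>n x\<close> to zero is convergence of its norm to zero. \<open>DIV_left\<close> renders
  \<open>DIV\<^bsub>A,\<bullet>\<^esub>\<close>.
\<close>

definition X_zero :: "'x set \<Rightarrow> ('x \<Rightarrow> real) \<Rightarrow> nat set \<Rightarrow> ('x \<Rightarrow> 'x) \<Rightarrow> 'x set" where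
  "X_zero X N A T =
    {x \<in> X. ((\<lambda>n. N ((T ^^ n) x)) \<longlongrightarrow> 0) (inf sequentially (principal A))}"

definition DIV_on :: "'x set \<Rightarrow> ('x \<Rightarrow> real) \<Rightarrow> nat set \<Rightarrow> nat set \<Rightarrow> ('x \<Rightarrow> 'x) \<Rightarrow> 'x set" where
  "DIV_on X N A B T =
    {x \<in> X. ((\<lambda>n. N ((T ^^ n) x)) \<longlongrightarrow> 0) (inf sequentially (principal A)) \<and>
            filterlim (\<lambda>n. N ((T ^^ n) x)) at_top (inf sequentially (principal B))}"

definition distributionally_irregular ::
    "'x set \<Rightarrow> ('x \<Rightarrow> real) \<Rightarrow> ('x \<Rightarrow> 'x) \<Rightarrow> 'x \<Rightarrow> bool" where
  "distributionally_irregular X N T x \<longleftrightarrow>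
    (\<exists>A B. full_upper_density A \<and> full_upper_density B \<and> x \<in> DIV_on X N A B T)"

definition DIV :: "'x set \<Rightarrow> ('x \<Rightarrow> real) \<Rightarrow> ('x \<Rightarrow> 'x) \<Rightarrow> 'x set" where
  "DIV X N T = {x. distributionally_irregular X N T x}"

definition DIV_left :: "'x set \<Rightarrow> ('x \<Rightarrow> real) \<Rightarrow> nat set \<Rightarrow> ('x \<Rightarrow> 'x) \<Rightarrow> 'x set" where
  "DIV_left X N A T = DIV X N T \<inter> X_zero X N A T"

lemma DIV_left_eq_Union:
  assumes "full_upper_density A"
  shows "DIV_left X N A T = (\<Union>B \<in> {B. full_upper_density B}. DIV_on X N A B T)"
  using assms
  by (auto simp: DIV_left_def DIV_def distributionally_irregular_def X_zero_def DIV_on_def)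

text \<open>
  Groups are written additively, following \<^class>\<open>topological_group_add\<close>; this class does not
  assume commutativity. Thus \<open>x a\<^sup>-\<^sup>1\<close> becomes \<open>x - a\<close>, which is \<open>x + (- a)\<close>.

  On a second countable locally compact Hausdorff space every Borel measure that is finite on
  compact sets is regular, so regularity need not be demanded of a Haar measure.
\<close>

definition right_Haar_measure :: "'g::{topological_space, plus} measure \<Rightarrow> bool" where
  "right_Haar_measure M \<longleftrightarrow>
    sets M = sets borel \<and>
    (\<forall>K. compact K \<longrightarrow> emeasure M K < \<infinity>) \<and>
    emeasure M UNIV \<noteq> 0 \<and>
    (\<forall>a. \<forall>E \<in> sets borel. emeasure M ((\<lambda>x. x + a) ` E) = emeasure M E)"

definition weight :: "('g::topological_space \<Rightarrow> real) \<Rightarrow> bool" where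
  "weight w \<longleftrightarrow> continuous_on UNIV w \<and> bounded (range w) \<and> (\<forall>x. 0 < w x)"

definition translation :: "'g::minus \<Rightarrow> ('g \<Rightarrow> complex) \<Rightarrow> 'g \<Rightarrow> complex" where
  "translation a f = (\<lambda>x. f (x - a))"

definition weighted_translation ::
    "real \<Rightarrow> 'g::minus measure \<Rightarrow> 'g \<Rightarrow> ('g \<Rightarrow> real) \<Rightarrow> ('g \<Rightarrow> complex) set \<Rightarrow> ('g \<Rightarrow> complex) set" where
  "weighted_translation p M a w F =
    Lp_class p M (\<lambda>x. complex_of_real (w x) * translation a (Lp_rep F) x)"

lemma
  fixes M :: "'g::{topological_group_add, t2_space, second_countable_topology} measure"
  assumes M: "right_Haar_measure M"
  shows measurable_right_translation: "(\<lambda>x. x - a) \<in> measurable M M"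
    and distr_right_translation: "distr M M (\<lambda>x. x - a) = M"
proof -
  have sets: "sets M = sets borel" using M by (simp add: right_Haar_measure_def)
  have "continuous_on UNIV (\<lambda>x. x - a)" by (intro continuous_intros)
  then have "(\<lambda>x. x - a) \<in> borel_measurable borel" by (rule borel_measurable_continuous_onI)
  then show meas: "(\<lambda>x. x - a) \<in> measurable M M"
    by (simp add: measurable_cong_sets[OF sets sets])
  have space: "space M = UNIV" using sets_eq_imp_space_eq[OF sets] by simp
  show "distr M M (\<lambda>x. x - a) = M"
  proof (rule measure_eqI)
    fix E assume "E \<in> sets (distr M M (\<lambda>x. x - a))"
    then have E: "E \<in> sets M" by simp
    have "(\<lambda>x. x - a) -` E \<inter> space M = (\<lambda>x. x + a) ` E"
      by (auto simp: space image_iff) (metis diff_add_cancel)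
    then show "emeasure (distr M M (\<lambda>x. x - a)) E = emeasure M E"
      using M E sets by (simp add: emeasure_distr[OF meas E] right_Haar_measure_def)
  qed simp
qed

lemma
  fixes M :: "'g::{topological_group_add, t2_space, second_countable_topology} measure"
  assumes M: "right_Haar_measure M" and w: "weight w" and p: "1 \<le> p" and f: "f \<in> Lp_funs p M"
  shows weighted_translation_in_funs:
      "(\<lambda>x. complex_of_real (w x) * translation a f x) \<in> Lp_funs p M"
    and weighted_translation_class:
      "weighted_translation p M a w (Lp_class p M f) =
        Lp_class p M (\<lambda>x. complex_of_real (w x) * translation a f x)"
proof -
  have sets: "sets M = sets borel" using M by (simp add: right_Haar_measure_def)
  note meas = measurable_right_translation[OF M, of a]
  have "w \<in> borel_measurable borel"
    using w by (intro borel_measurable_continuous_onI) (simp add: weight_def)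
  then have wm [measurable]: "w \<in> borel_measurable M"
    by (simp add: measurable_cong_sets[OF sets refl])
  obtain c where c: "\<And>x. \<bar>w x\<bar> \<le> c"
    using w unfolding weight_def bounded_iff by (metis rangeI real_norm_def)
  have in_funs: "(\<lambda>x. complex_of_real (w x) * translation a g x) \<in> Lp_funs p M"
    if g: "g \<in> Lp_funs p M" for g
  proof -
    have gm: "(\<lambda>x. g (x - a)) \<in> borel_measurable M"
      using measurable_compose[OF meas Lp_funsD[OF g]] .
    have "integrable (distr M M (\<lambda>x. x - a)) (\<lambda>x. norm (g x) powr p)"
      using g by (simp add: distr_right_translation[OF M] Lp_funs_def)
    then have "integrable M (\<lambda>x. norm (g (x - a)) powr p)"
      by (rule integrable_distr[OF meas])
    then have "integrable M (\<lambda>x. c powr p * norm (g (x - a)) powr p)" by simp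
    then have "integrable M (\<lambda>x. norm (complex_of_real (w x) * g (x - a)) powr p)"
      using gm c p
      by (elim Bochner_Integration.integrable_bound)
         (auto simp: norm_mult powr_mult intro!: AE_I2 mult_right_mono powr_mono2)
    then show ?thesis using gm by (simp add: Lp_funs_def translation_def)
  qed
  show "(\<lambda>x. complex_of_real (w x) * translation a f x) \<in> Lp_funs p M"
    by (rule in_funs[OF f])
  let ?r = "Lp_rep (Lp_class p M f)"
  have "AE x in distr M M (\<lambda>x. x - a). ?r x = f x"
    by (subst distr_right_translation[OF M]) (rule Lp_rep_class[OF f])
  then have "AE x in M. ?r (x - a) = f (x - a)"
    by (rule AE_distrD[OF meas])
  then have "AE x in M. complex_of_real (w x) * translation a ?r x =
      complex_of_real (w x) * translation a f x"
    by eventually_elim (simp add: translation_def)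
  then show "weighted_translation p M a w (Lp_class p M f) =
        Lp_class p M (\<lambda>x. complex_of_real (w x) * translation a f x)"
    unfolding weighted_translation_def
    using Lp_class_eq_iff[OF in_funs[OF Lp_rep_in_funs[OF Lp_class_in_Lp[OF f]]] in_funs[OF f]]
    by simp
qed

end

theory Submission
  imports Defs
begin

text \<open>
  Let \<open>S f x = w x * f (x - a)\<close>. Each iterate \<open>S\<^sup>n\<close> is linear and preserves
  pointwise inequalities between moduli, so \<open>\<parallel>S\<^sup>n f\<parallel>\<close> depends only on \<open>\<bar>f\<bar>\<close> and is monotone in it.
  Membership of \<open>k\<close> in \<open>DIV\<^bsub>A,\<bullet>\<^esub>\<close> can therefore be read off from pointwise bounds
  (\<open>DIV_left_sandwich\<close>): if \<open>f\<close> and \<open>g\<close> belong to it, an upper bound \<open>\<bar>k\<bar> \<le> \<bar>f\<bar> + \<bar>g\<bar>\<close> forces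
  \<open>\<parallel>S\<^sup>n k\<parallel> \<rightarrow> 0\<close> along \<open>A\<close>, and a lower bound \<open>\<bar>f\<bar> \<le> 2 \<bar>k\<bar>\<close> makes \<open>\<parallel>S\<^sup>n k\<parallel>\<close> diverge along the same
  index set as \<open>\<parallel>S\<^sup>n f\<parallel>\<close>.

  The straight segment from \<open>f\<close> to \<open>g\<close> satisfies the upper bound but not the lower one, since
  \<open>f x\<close> and \<open>g x\<close> may point in opposite directions and cancel. The path
  takes a detour through a function \<open>h\<close> with \<open>\<bar>h\<bar> = max \<bar>f\<bar> \<bar>g\<bar>\<close> whose value at every point makes
  an angle of at most \<open>\<pi> / 2\<close> with both \<open>f x\<close> and \<open>g x\<close>: it is the longer of the two numbers,
  turned by a right angle towards the other one (\<open>detour\<close>). Two vectors at an angle of at most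
  \<open>\<pi> / 2\<close> do not cancel (\<open>norm_segment_ge\<close>), so both segments \<open>f h\<close> and \<open>g h\<close> stay in
  \<open>DIV\<^bsub>A,\<bullet>\<^esub>\<close>.
\<close>

section \<open>Segments and detours in the plane\<close>

text \<open>
  The cross term in \<open>\<parallel>(1 - t) u + t v\<parallel>\<^sup>2\<close> is nonnegative, hence this square is at least
  \<open>((1 - t)\<^sup>2 + t\<^sup>2) \<parallel>u\<parallel>\<^sup>2 \<ge> \<parallel>u\<parallel>\<^sup>2 / 2\<close>. The rounder constant \<open>1 / 4\<close> avoids a square root.
\<close>

lemma norm_segment_ge:
  fixes u v :: "'a::real_inner"
  assumes "0 \<le> u \<bullet> v" "norm u \<le> norm v" "0 \<le> t" "t \<le> 1"
  shows "norm u \<le> 2 * norm ((1 - t) *\<^sub>R u + t *\<^sub>R v)"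
proof -
  have "(norm u)\<^sup>2 \<le> (norm v)\<^sup>2"
    using assms by (intro power_mono) auto
  then have "t\<^sup>2 * (norm u)\<^sup>2 \<le> t\<^sup>2 * (norm v)\<^sup>2"
    by (intro mult_left_mono) auto
  moreover have "0 \<le> (1 - t) * t * (u \<bullet> v)"
    using assms by simp
  moreover have "(norm ((1 - t) *\<^sub>R u + t *\<^sub>R v))\<^sup>2
      = (1 - t)\<^sup>2 * (norm u)\<^sup>2 + 2 * ((1 - t) * t * (u \<bullet> v)) + t\<^sup>2 * (norm v)\<^sup>2"
    unfolding power2_norm_eq_inner
    by (simp add: inner_add_left inner_add_right inner_commute power2_eq_square algebra_simps)
  ultimately have "((1 - t)\<^sup>2 + t\<^sup>2) * (norm u)\<^sup>2 \<le> (norm ((1 - t) *\<^sub>R u + t *\<^sub>R v))\<^sup>2"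
    by (simp add: distrib_right)
  moreover have "1 / 4 \<le> (1 - t)\<^sup>2 + t\<^sup>2"
    using zero_le_power2[of "2 * t - 1"] by (simp add: power2_eq_square algebra_simps)
  then have "1 / 4 * (norm u)\<^sup>2 \<le> ((1 - t)\<^sup>2 + t\<^sup>2) * (norm u)\<^sup>2"
    by (intro mult_right_mono) auto
  ultimately have "(norm u)\<^sup>2 \<le> (2 * norm ((1 - t) *\<^sub>R u + t *\<^sub>R v))\<^sup>2"
    by (simp add: power_mult_distrib)
  then show ?thesis
    by (rule power2_le_imp_le) simp
qed

definition turn_towards :: "complex \<Rightarrow> complex \<Rightarrow> complex" where
  "turn_towards u v = (if 0 \<le> v \<bullet> (\<i> * u) then \<i> * u else - (\<i> * u))"

text \<open>
  Turning the longer number keeps its size maximal, so that the detour dominates both numbers and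
  does not vanish unless both do.
\<close>

definition detour :: "complex \<Rightarrow> complex \<Rightarrow> complex" where
  "detour u v = (if norm v \<le> norm u then turn_towards u v else turn_towards v u)"

lemma norm_detour: "norm (detour u v) = max (norm u) (norm v)"
  by (simp add: detour_def turn_towards_def norm_mult max_def)

lemma inner_turn_towards: "u \<bullet> turn_towards u v = 0" "0 \<le> v \<bullet> turn_towards u v"
  by (auto simp: turn_towards_def inner_complex_def)

lemma inner_detour: "0 \<le> u \<bullet> detour u v" "0 \<le> v \<bullet> detour u v"
  by (simp_all add: detour_def inner_turn_towards)

lemma measurable_detour:
  assumes [measurable]: "f \<in> borel_measurable M" "g \<in> borel_measurable M"
  shows "(\<lambda>x. detour (f x) (g x)) \<in> borel_measurable M"
  unfolding detour_def turn_towards_def by measurable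

section \<open>Segments in the space of p-integrable functions\<close>

lemma Lp_funs_norm: "f \<in> Lp_funs p M \<Longrightarrow> (\<lambda>x. complex_of_real (norm (f x))) \<in> Lp_funs p M"
  by (auto simp: Lp_funs_def intro: measurable_compose[OF _ borel_measurable_of_real])

lemma Lp_funs_bound:
  assumes "f \<in> Lp_funs p M" "1 \<le> p" "g \<in> borel_measurable M"
    and "\<And>x. norm (g x) \<le> norm (f x)"
  shows "g \<in> Lp_funs p M"
proof -
  have "integrable M (\<lambda>x. norm (g x) powr p)"
    by (rule Bochner_Integration.integrable_bound[of M "\<lambda>x. norm (f x) powr p"])
       (use assms in \<open>auto simp: Lp_funs_def intro!: AE_I2 powr_mono2\<close>)
  then show ?thesis
    using assms by (simp add: Lp_funs_def)
qed

lemma Lp_funs_scaleR: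
  assumes "f \<in> Lp_funs p M"
  shows "(\<lambda>x. c *\<^sub>R f x) \<in> Lp_funs p M"
  using assms by (auto simp: Lp_funs_def powr_mult)

lemma Lp_seminorm_nonneg: "0 \<le> Lp_seminorm p M f"
  by (simp add: Lp_seminorm_def)

lemma Lp_seminorm_mono:
  assumes "f \<in> Lp_funs p M" "g \<in> Lp_funs p M" "1 \<le> p"
    and "\<And>x. norm (f x) \<le> norm (g x)"
  shows "Lp_seminorm p M f \<le> Lp_seminorm p M g"
  unfolding Lp_seminorm_def
  using assms by (intro powr_mono2 integral_mono) (auto simp: Lp_funs_def intro!: powr_mono2)

lemma Lp_seminorm_scaleR:
  assumes "1 \<le> p"
  shows "Lp_seminorm p M (\<lambda>x. c *\<^sub>R f x) = \<bar>c\<bar> * Lp_seminorm p M f"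
  using assms by (simp add: Lp_seminorm_def powr_mult powr_powr)

text \<open>
  Points of the segment at parameters \<open>s\<close> and \<open>t\<close> differ by \<open>(t - s) (h - f)\<close>, so the segment is
  Lipschitz in its parameter.
\<close>

lemma continuous_map_Lp_segment:
  assumes p: "1 \<le> p" and f: "f \<in> Lp_funs p M" and h: "h \<in> Lp_funs p M"
  shows "continuous_map euclideanreal (Lp_topology p M)
    (\<lambda>t. Lp_class p M (\<lambda>x. (1 - t) *\<^sub>R f x + t *\<^sub>R h x))"
proof -
  interpret Metric_space "Lp p M" "Lp_dist p M"
    by (rule Metric_space_Lp[OF p])
  let ?s = "\<lambda>t x. (1 - t) *\<^sub>R f x + t *\<^sub>R h x"
  let ?L = "Lp_seminorm p M (\<lambda>x. h x - f x)"
  have seg: "?s t \<in> Lp_funs p M" for t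
    using Lp_funs_add[OF p Lp_funs_scaleR[OF f] Lp_funs_scaleR[OF h]] .
  have dist: "Lp_dist p M (Lp_class p M (?s t)) (Lp_class p M (?s s)) = \<bar>t - s\<bar> * ?L" for s t
  proof -
    have "(\<lambda>x. ?s t x - ?s s x) = (\<lambda>x. (t - s) *\<^sub>R (h x - f x))"
      by (auto simp: algebra_simps)
    then show ?thesis
      by (simp only: Lp_dist_class[OF seg seg] Lp_seminorm_scaleR[OF p])
  qed
  show ?thesis
    unfolding Lp_topology_def continuous_map_to_metric
  proof (intro ballI allI impI)
    fix t e :: real
    assume e: "0 < e"
    \<comment> \<open>The summand 1 keeps the denominator positive when \<open>f\<close> and \<open>h\<close> agree almost everywhere.\<close>
    define d where "d = e / (?L + 1)"
    have L: "0 < ?L + 1"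
      using Lp_seminorm_nonneg[of p M "\<lambda>x. h x - f x"] by linarith
    have "Lp_class p M (?s s) \<in> mball (Lp_class p M (?s t)) e" if "s \<in> ball t d" for s
    proof -
      have "\<bar>t - s\<bar> * ?L \<le> \<bar>t - s\<bar> * (?L + 1)"
        by (intro mult_left_mono) auto
      also have "\<dots> < e"
        using that L by (simp add: d_def dist_real_def pos_less_divide_eq)
      finally show ?thesis
        by (simp add: dist Lp_class_in_Lp[OF seg])
    qed
    then show "\<exists>U. openin euclideanreal U \<and> t \<in> U \<and>
        (\<forall>s\<in>U. Lp_class p M (?s s) \<in> mball (Lp_class p M (?s t)) e)"
      using e L by (intro exI[of _ "ball t d"]) (auto simp: d_def)
  qed
qed

section \<open>Iterates of a weighted translation\<close>

text \<open>
  The action of the weighted translation on functions rather than on classes, where the iterates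
  can be compared pointwise.
\<close>

definition weighted_shift :: "'g::minus \<Rightarrow> ('g \<Rightarrow> real) \<Rightarrow> ('g \<Rightarrow> complex) \<Rightarrow> 'g \<Rightarrow> complex" where
  "weighted_shift a w f = (\<lambda>x. complex_of_real (w x) * translation a f x)"

lemma weighted_shift_add:
  "weighted_shift a w (\<lambda>x. f x + g x) = (\<lambda>x. weighted_shift a w f x + weighted_shift a w g x)"
  by (simp add: weighted_shift_def translation_def algebra_simps)

lemma weighted_shift_scaleR:
  "weighted_shift a w (\<lambda>x. c *\<^sub>R f x) = (\<lambda>x. c *\<^sub>R weighted_shift a w f x)"
  by (simp add: weighted_shift_def translation_def)

lemma funpow_weighted_shift_add:
  "(weighted_shift a w ^^ n) (\<lambda>x. f x + g x)
    = (\<lambda>x. (weighted_shift a w ^^ n) f x + (weighted_shift a w ^^ n) g x)"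
  by (induction n) (simp_all add: weighted_shift_add)

lemma funpow_weighted_shift_scaleR:
  "(weighted_shift a w ^^ n) (\<lambda>x. c *\<^sub>R f x) = (\<lambda>x. c *\<^sub>R (weighted_shift a w ^^ n) f x)"
  by (induction n) (simp_all add: weighted_shift_scaleR)

text \<open>
  A single step only multiplies moduli by a factor that is the same for both functions, which is
  why no explicit formula for the iterates is required.
\<close>

lemma norm_funpow_weighted_shift_mono:
  assumes "\<And>x. norm (f x) \<le> norm (g x)"
  shows "norm ((weighted_shift a w ^^ n) f x) \<le> norm ((weighted_shift a w ^^ n) g x)"
proof (induction n arbitrary: x)
  case 0
  show ?case using assms by simp
next
  case (Suc n)
  show ?case
    using Suc.IH[of "x - a"]
    by (simp add: weighted_shift_def translation_def norm_mult mult_left_mono)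
qed

context
  fixes M :: "'g::{topological_group_add, t2_space, second_countable_topology} measure"
    and w :: "'g \<Rightarrow> real" and p :: real
  assumes M: "right_Haar_measure M" and w: "weight w" and p: "1 \<le> p"
begin

lemma funpow_weighted_shift_in_funs:
  "f \<in> Lp_funs p M \<Longrightarrow> (weighted_shift a w ^^ n) f \<in> Lp_funs p M"
  by (induction n)
     (use weighted_translation_in_funs[OF M w p] in \<open>auto simp: weighted_shift_def\<close>)

lemma funpow_weighted_translation_class:
  assumes "f \<in> Lp_funs p M"
  shows "(weighted_translation p M a w ^^ n) (Lp_class p M f)
    = Lp_class p M ((weighted_shift a w ^^ n) f)"
proof (induction n)
  case (Suc n)
  have "weighted_translation p M a w (Lp_class p M ((weighted_shift a w ^^ n) f))
      = Lp_class p M (weighted_shift a w ((weighted_shift a w ^^ n) f))"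
    using weighted_translation_class[OF M w p funpow_weighted_shift_in_funs[OF assms]]
    by (simp only: weighted_shift_def)
  with Suc show ?case
    by simp
qed simp

lemma Lp_norm_funpow_weighted_translation:
  assumes "f \<in> Lp_funs p M"
  shows "Lp_norm p M ((weighted_translation p M a w ^^ n) (Lp_class p M f))
    = Lp_seminorm p M ((weighted_shift a w ^^ n) f)"
  by (simp add: funpow_weighted_translation_class assms Lp_norm_class funpow_weighted_shift_in_funs)

lemma Lp_seminorm_funpow_mono:
  assumes "f \<in> Lp_funs p M" "g \<in> Lp_funs p M" "\<And>x. norm (f x) \<le> norm (g x)"
  shows "Lp_seminorm p M ((weighted_shift a w ^^ n) f)
    \<le> Lp_seminorm p M ((weighted_shift a w ^^ n) g)"
  using assms p
  by (intro Lp_seminorm_mono funpow_weighted_shift_in_funs norm_funpow_weighted_shift_mono)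

text \<open>
  The iterates respect domination by a single function, hence the passage through \<open>\<bar>f\<bar> + \<bar>g\<bar>\<close>, which
  linearity then splits.
\<close>

lemma Lp_seminorm_funpow_dominated:
  assumes f: "f \<in> Lp_funs p M" and g: "g \<in> Lp_funs p M" and k: "k \<in> Lp_funs p M"
    and le: "\<And>x. norm (k x) \<le> norm (f x) + norm (g x)"
  shows "Lp_seminorm p M ((weighted_shift a w ^^ n) k)
    \<le> Lp_seminorm p M ((weighted_shift a w ^^ n) f) + Lp_seminorm p M ((weighted_shift a w ^^ n) g)"
proof -
  let ?S = "weighted_shift a w ^^ n"
  let ?f = "\<lambda>x. complex_of_real (norm (f x))" and ?g = "\<lambda>x. complex_of_real (norm (g x))"
  note fg = Lp_funs_norm[OF f] Lp_funs_norm[OF g]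
  have "norm (k x) \<le> norm (?f x + ?g x)" for x
    using le[of x] by (simp flip: of_real_add)
  then have "Lp_seminorm p M (?S k) \<le> Lp_seminorm p M (?S (\<lambda>x. ?f x + ?g x))"
    by (intro Lp_seminorm_funpow_mono k Lp_funs_add p fg)
  also have "\<dots> \<le> Lp_seminorm p M (?S ?f) + Lp_seminorm p M (?S ?g)"
    unfolding funpow_weighted_shift_add
    by (intro Lp_seminorm_triangle p funpow_weighted_shift_in_funs fg)
  also have "\<dots> \<le> Lp_seminorm p M (?S f) + Lp_seminorm p M (?S g)"
    by (intro add_mono Lp_seminorm_funpow_mono f g fg) auto
  finally show ?thesis .
qed

lemma Lp_seminorm_funpow_scaleR:
  "Lp_seminorm p M ((weighted_shift a w ^^ n) (\<lambda>x. c *\<^sub>R f x))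
    = \<bar>c\<bar> * Lp_seminorm p M ((weighted_shift a w ^^ n) f)"
  by (simp only: funpow_weighted_shift_scaleR Lp_seminorm_scaleR[OF p])

section \<open>Paths of distributionally irregular vectors\<close>

text \<open>
  Decay along \<open>A\<close> descends from the upper bound. Divergence is inherited from \<open>f\<close>, so a set \<open>B\<close> that
  witnesses it for \<open>f\<close> also does so for \<open>k\<close>.
\<close>

lemma DIV_left_sandwich:
  assumes A: "full_upper_density A"
    and f: "f \<in> Lp_funs p M" and g: "g \<in> Lp_funs p M" and k: "k \<in> Lp_funs p M"
    and Df: "Lp_class p M f \<in> DIV_left (Lp p M) (Lp_norm p M) A (weighted_translation p M a w)"
    and Dg: "Lp_class p M g \<in> DIV_left (Lp p M) (Lp_norm p M) A (weighted_translation p M a w)"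
    and lower: "\<And>x. norm (f x) \<le> 2 * norm (k x)"
    and upper: "\<And>x. norm (k x) \<le> norm (f x) + norm (g x)"
  shows "Lp_class p M k \<in> DIV_left (Lp p M) (Lp_norm p M) A (weighted_translation p M a w)"
proof -
  let ?S = "\<lambda>n. weighted_shift a w ^^ n" and ?N = "Lp_seminorm p M"
  let ?A = "inf sequentially (principal A)"
  obtain B where B: "full_upper_density B"
    and f0: "((\<lambda>n. ?N (?S n f)) \<longlongrightarrow> 0) ?A"
    and finf: "filterlim (\<lambda>n. ?N (?S n f)) at_top (inf sequentially (principal B))"
    using Df by (auto simp: DIV_left_eq_Union[OF A] DIV_on_def
        Lp_norm_funpow_weighted_translation[OF f])
  have g0: "((\<lambda>n. ?N (?S n g)) \<longlongrightarrow> 0) ?A"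
    using Dg by (auto simp: DIV_left_eq_Union[OF A] DIV_on_def
        Lp_norm_funpow_weighted_translation[OF g])
  have sum0: "((\<lambda>n. ?N (?S n f) + ?N (?S n g)) \<longlongrightarrow> 0) ?A"
    using tendsto_add[OF f0 g0] by simp
  have k0: "((\<lambda>n. ?N (?S n k)) \<longlongrightarrow> 0) ?A"
    by (rule tendsto_sandwich[OF _ _ tendsto_const sum0])
       (simp_all add: Lp_seminorm_nonneg Lp_seminorm_funpow_dominated[OF f g k upper])
  have "?N (?S n f) \<le> 2 * ?N (?S n k)" for n
    using Lp_seminorm_funpow_mono[OF f Lp_funs_scaleR[OF k, of 2], where a = a and n = n] lower
    by (simp add: Lp_seminorm_funpow_scaleR)
  then have "filterlim (\<lambda>n. 2 * ?N (?S n k)) at_top (inf sequentially (principal B))"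
    by (intro filterlim_at_top_mono[OF finf] always_eventually allI)
  then have kinf: "filterlim (\<lambda>n. ?N (?S n k)) at_top (inf sequentially (principal B))"
    by (simp add: filterlim_tendsto_pos_mult_at_top_iff[OF tendsto_const])
  show ?thesis
    using B k0 kinf by (auto simp: DIV_left_eq_Union[OF A] DIV_on_def Lp_class_in_Lp[OF k]
        Lp_norm_funpow_weighted_translation[OF k])
qed

text \<open>
  Divergence along the whole segment comes from \<open>f\<close>, which the angle condition protects from being
  cancelled; the role of \<open>g\<close> is to bound \<open>h\<close> at the points where \<open>h\<close> is longer than \<open>f\<close>.
\<close>

lemma DIV_left_segment:
  assumes A: "full_upper_density A"
    and f: "f \<in> Lp_funs p M" and g: "g \<in> Lp_funs p M" and h: "h \<in> Lp_funs p M"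
    and Df: "Lp_class p M f \<in> DIV_left (Lp p M) (Lp_norm p M) A (weighted_translation p M a w)"
    and Dg: "Lp_class p M g \<in> DIV_left (Lp p M) (Lp_norm p M) A (weighted_translation p M a w)"
    and angle: "\<And>x. 0 \<le> f x \<bullet> h x"
    and max: "\<And>x. norm (h x) = max (norm (f x)) (norm (g x))"
  shows "path_component_of (subtopology (Lp_topology p M)
      (DIV_left (Lp p M) (Lp_norm p M) A (weighted_translation p M a w)))
    (Lp_class p M f) (Lp_class p M h)"
proof -
  let ?D = "DIV_left (Lp p M) (Lp_norm p M) A (weighted_translation p M a w)"
  let ?s = "\<lambda>t x. (1 - t) *\<^sub>R f x + t *\<^sub>R h x"
  have "Lp_class p M (?s t) \<in> ?D" if t: "t \<in> {0..1}" for t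
  proof (rule DIV_left_sandwich[OF A f g _ Df Dg])
    show "?s t \<in> Lp_funs p M"
      by (intro Lp_funs_add Lp_funs_scaleR p f h)
    show "norm (f x) \<le> 2 * norm (?s t x)" for x
      using t by (intro norm_segment_ge angle) (auto simp: max)
    have "norm (?s t x) \<le> (1 - t) * norm (f x) + t * norm (h x)" for x
      using t norm_triangle_ineq[of "(1 - t) *\<^sub>R f x" "t *\<^sub>R h x"] by simp
    also have "\<dots> x \<le> norm (h x)" for x
      using t by (intro convex_bound_le) (auto simp: max)
    also have "\<dots> x \<le> norm (f x) + norm (g x)" for x
      by (simp add: max)
    finally show "norm (?s t x) \<le> norm (f x) + norm (g x)" for x .
  qed
  then have "pathin (subtopology (Lp_topology p M) ?D) (\<lambda>t. Lp_class p M (?s t))"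
    unfolding pathin_def
    by (intro continuous_map_into_subtopology continuous_map_from_subtopology
        continuous_map_Lp_segment p f h) auto
  then show ?thesis
    unfolding path_component_of_def
    by (intro exI[of _ "\<lambda>t. Lp_class p M (?s t)"]) simp
qed

end

theorem theorem3p12:
  fixes M :: "'g::{topological_group_add, t2_space, second_countable_topology} measure"
    and a :: 'g and w :: "'g \<Rightarrow> real" and p :: real and A B :: "nat set"
  assumes "locally_compact_space (euclidean :: 'g topology)"
    and "right_Haar_measure M"
    and "weight w"
    and "1 \<le> p"
    and "full_upper_density A" and "full_upper_density B"
    and "DIV_on (Lp p M) (Lp_norm p M) A B (weighted_translation p M a w) \<noteq> {}"
  shows "path_connectedin (Lp_topology p M)
           (DIV_left (Lp p M) (Lp_norm p M) A (weighted_translation p M a w))"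
proof -
  note M = assms(2) and w = assms(3) and p = assms(4) and A = assms(5)
  let ?D = "DIV_left (Lp p M) (Lp_norm p M) A (weighted_translation p M a w)"
  let ?X = "subtopology (Lp_topology p M) ?D"
  have sub: "?D \<subseteq> Lp p M"
    by (auto simp: DIV_left_def X_zero_def)
  have top: "topspace (Lp_topology p M) = Lp p M"
    by (simp add: Lp_topology_def Metric_space.topspace_mtopology[OF Metric_space_Lp[OF p]])
  have "path_component_of ?X F G" if F: "F \<in> ?D" and G: "G \<in> ?D" for F G
  proof -
    define f g where "f = Lp_rep F" and "g = Lp_rep G"
    define h where "h = (\<lambda>x. detour (f x) (g x))"
    have f: "f \<in> Lp_funs p M" and g: "g \<in> Lp_funs p M"
      and eq: "Lp_class p M f = F" "Lp_class p M g = G"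
      using F G sub by (auto simp: f_def g_def Lp_rep_in_funs Lp_class_rep)
    have h: "h \<in> Lp_funs p M"
    proof (rule Lp_funs_bound[OF Lp_funs_add[OF p Lp_funs_norm[OF f] Lp_funs_norm[OF g]] p])
      show "h \<in> borel_measurable M"
        unfolding h_def by (intro measurable_detour Lp_funsD[OF f] Lp_funsD[OF g])
      show "norm (h x) \<le> norm (complex_of_real (norm (f x)) + complex_of_real (norm (g x)))" for x
        by (simp add: h_def norm_detour flip: of_real_add)
    qed
    \<comment> \<open>The detour is symmetric in what is required of it, so the same segment lemma joins it to
      both ends.\<close>
    have "path_component_of ?X F (Lp_class p M h)"
      using DIV_left_segment[OF M w p A f g h] F G
      by (simp add: eq h_def norm_detour inner_detour)
    moreover have "path_component_of ?X G (Lp_class p M h)"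
      using DIV_left_segment[OF M w p A g f h] F G
      by (simp add: eq h_def norm_detour inner_detour max.commute)
    ultimately show ?thesis
      by (meson path_component_of_sym path_component_of_trans)
  qed
  then show ?thesis
    using sub
    by (auto simp: path_connectedin_def path_connected_space_iff_path_component top)
qed

end
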